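(* Let $G$ be a threshold graph of size $n$ with a given construction sequence $T^G\in\{0,1\}^n$, with nodes indexed $1,\dots,n$ by the construction steps. Let $V(G)\in\mathbb{R}^{n\times n}$ be the matrix output by Algorithm 1 (described in the context) on input $T^G$. Then $V(G)$ is a modal matrix of $G$ associated with the spectrum $\Lambda(G)=(0,\lambda_2,\ldots,\lambda_n)$ of $L(G)$ ordered so that $0\le\lambda_2\le\cdots\le\lambda_n$; that is, $V(G)$ is nonsingular and $L(G)V(G)=V(G)\,\mathrm{diag}(0,\lambda_2,\ldots,\lambda_n)$.
   Context: All graphs are finite, undirected, unweighted and loop-free. $L(G)=\Delta(G)-A(G)$ is the Laplacian matrix, with $\Delta(G)$ the diagonal matrix of node degrees and $A(G)$ the $(0,1)$-adjacency matrix. The spectrum $\Lambda(G)$ lists the eigenvalues of $L(G)$ with multiplicity in nondecreasing order. Threshold graph and construction sequence: a sequence $T^G\in\{0,1\}^n$ with $T^G(1)=0$ determines a graph $G$ on $\{1,\dots,n\}$ as follows. Start with the single node $1$. For $i=2,\dots,n$, add node $i$ to the graph built so far on $\{1,\dots,i-1\}$: if $T^G(i)=0$ (union), node $i$ is added as an isolated node; if $T^G(i)=1$ (join), node $i$ is added and made adjacent to all of $1,\dots,i-1$. Graphs obtained this way are called threshold graphs, and $T^G$ is the construction sequence of $G$. For $1\le i\le n-1$ let $\mathcal{C}(i)\in\mathbb{R}^n$ be the column vector whose first $i$ entries equal $1$, whose $(i+1)$-th entry equals $-i$, and whose remaining $n-i-1$ entries equal $0$. Algorithm 1. Input: $T^G$.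 Output: $V(G)$, with columns denoted $V_{:,j}(G)$. Set $V_{:,1}(G)=\mathbf{1}_n$ (the all-ones vector), $k=1$, $r=0$. For $i=n,n-1,\dots,2$ (in decreasing order): if $T^G(i)=0$, set $k:=k+1$ and then $V_{:,k}(G):=\mathcal{C}(i-1)$; otherwise set $V_{:,n-r}(G):=\mathcal{C}(i-1)$ and then $r:=r+1$. Return $V(G)$. *)

theory Defs
  imports
    "Graph_Theory.Pair_Digraph"
    "Jordan_Normal_Form.Char_Poly"
begin

text \<open>
  A finite simple graph is a \<^locale>\<open>pair_graph\<close>, i.e. a finite, loop-free, symmetric set of
  ordered pairs. The matrices below presuppose the vertex set \<open>{1..n}\<close>; vertex \<open>i\<close> corresponds to
  the matrix index \<open>i - 1\<close>, since matrices are indexed from 0.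
\<close>

definition adjacency_matrix :: "nat pair_pre_digraph \<Rightarrow> real mat" where
  "adjacency_matrix G =
    (let n = card (pverts G)
     in mat n n (\<lambda>(i, j). if (Suc i, Suc j) \<in> parcs G then 1 else 0))"

text \<open>By symmetry of the arc relation, the out-degree is the degree of the undirected graph.\<close>

definition degree_matrix :: "nat pair_pre_digraph \<Rightarrow> real mat" where
  "degree_matrix G = mat_diag (card (pverts G)) (\<lambda>i. real (out_degree (with_proj G) (Suc i)))"

definition laplacian :: "nat pair_pre_digraph \<Rightarrow> real mat" where
  "laplacian G = degree_matrix G - adjacency_matrix G"

definition laplacian_spectrum :: "nat pair_pre_digraph \<Rightarrow> real list" where
  "laplacian_spectrum G = sorted_list_of_multiset (proots (char_poly (laplacian G)))"

definition modal_matrix :: "real mat \<Rightarrow> real list \<Rightarrow> real mat \<Rightarrow> bool" where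
  "modal_matrix L ls V \<longleftrightarrow>
     V \<in> carrier_mat (dim_row L) (length ls) \<and> invertible_mat V \<and>
     L * V = V * mat_diag (length ls) (\<lambda>i. ls ! i)"

definition construction_sequence :: "nat \<Rightarrow> (nat \<Rightarrow> nat) \<Rightarrow> bool" where
  "construction_sequence n T \<longleftrightarrow> 1 \<le> n \<and> (\<forall>i\<in>{1..n}. T i \<in> {0, 1}) \<and> T 1 = 0"

definition union_node :: "nat \<Rightarrow> nat pair_pre_digraph \<Rightarrow> nat pair_pre_digraph" where
  "union_node v G = \<lparr>pverts = insert v (pverts G), parcs = parcs G\<rparr>"

definition join_node :: "nat \<Rightarrow> nat pair_pre_digraph \<Rightarrow> nat pair_pre_digraph" where
  "join_node v G =
     \<lparr>pverts = insert v (pverts G),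
      parcs = parcs G \<union> {v} \<times> pverts G \<union> pverts G \<times> {v}\<rparr>"

text \<open>
  The second argument is the number of construction steps; \<open>0\<close> only makes the function total.
\<close>

fun threshold_graph :: "(nat \<Rightarrow> nat) \<Rightarrow> nat \<Rightarrow> nat pair_pre_digraph" where
  "threshold_graph T 0 = \<lparr>pverts = {}, parcs = {}\<rparr>"
| "threshold_graph T (Suc 0) = \<lparr>pverts = {1}, parcs = {}\<rparr>"
| "threshold_graph T (Suc (Suc m)) =
     (let i = Suc (Suc m); H = threshold_graph T (Suc m)
      in if T i = 0 then union_node i H else join_node i H)"

lemma pverts_threshold_graph: "pverts (threshold_graph T n) = {1..n}"
  by (induction T n rule: threshold_graph.induct)
    (auto simp: Let_def union_node_def join_node_def)

lemma pair_graph_threshold_graph: "pair_graph (threshold_graph T n)"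
proof -
  have arcs: "parcs (threshold_graph T n) \<subseteq> {1..n} \<times> {1..n}
      \<and> (\<forall>(u, v) \<in> parcs (threshold_graph T n). u \<noteq> v)
      \<and> sym (parcs (threshold_graph T n))"
  proof (induction T n rule: threshold_graph.induct)
    case (3 T m)
    then show ?case
      using pverts_threshold_graph[of T "Suc m"]
      by (simp add: Let_def union_node_def join_node_def sym_def) fastforce
  qed (auto simp: sym_def)
  then have "finite (parcs (threshold_graph T n))"
    by (meson finite_SigmaI finite_atLeastAtMost finite_subset)
  with arcs pverts_threshold_graph[of T n] show ?thesis
    by unfold_locales (auto simp: symmetric_def arcs_ends_conv)
qed

text \<open>
  Vector indices start at 0: the first \<open>i\<close> entries are those at \<open>0, \<dots>, i - 1\<close>, and the
  \<open>(i + 1)\<close>-th entry is the one at \<open>i\<close>.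
\<close>

definition cvec :: "nat \<Rightarrow> nat \<Rightarrow> real vec" where
  "cvec n i = vec n (\<lambda>j. if j < i then 1 else if j = i then - real i else 0)"

text \<open>
  The state is \<open>(V, k, r)\<close>, where \<open>V j\<close> is the \<open>j\<close>-th column, \<open>j\<close> ranging over \<open>{1..n}\<close>.
  The zero vector stands for a column that has not been assigned yet; a column left in this state
  would make the output singular.
\<close>

type_synonym alg_state = "(nat \<Rightarrow> real vec) \<times> nat \<times> nat"

definition alg_init :: "nat \<Rightarrow> alg_state" where
  "alg_init n = ((\<lambda>_. 0\<^sub>v n)(1 := vec n (\<lambda>_. 1)), 1, 0)"

definition alg_step :: "nat \<Rightarrow> (nat \<Rightarrow> nat) \<Rightarrow> nat \<Rightarrow> alg_state \<Rightarrow> alg_state" where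
  "alg_step n T i = (\<lambda>(V, k, r).
     if T i = 0 then (V(k + 1 := cvec n (i - 1)), k + 1, r)
     else (V(n - r := cvec n (i - 1)), k, r + 1))"

definition alg_output :: "nat \<Rightarrow> (nat \<Rightarrow> nat) \<Rightarrow> real mat" where
  "alg_output n T =
     (let (V, k, r) = fold (alg_step n T) (rev [2..<Suc n]) (alg_init n)
      in mat_of_cols n (map V [1..<Suc n]))"

end

theory Submission
  imports Defs
begin

text \<open>
  Pair every node \<open>i\<close> with one column: node \<open>1\<close> with the all-ones vector, node \<open>i \<ge> 2\<close> with
  \<open>\<C>(i - 1)\<close>. Two nodes are adjacent exactly when the later one was added by a join
  (\<open>parcs_threshold_graph\<close>), so a node treats all earlier nodes alike. This makes each of these
  columns an eigenvector (\<open>laplacian_mult_node_column\<close>). Writing \<open>J i\<close> for the number of joins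
  after step \<open>i\<close>, the eigenvalue for \<open>i \<ge> 2\<close> is \<open>J i\<close> if \<open>i\<close> is a union and \<open>J i + i\<close> if it is a
  join. The columns do not depend on the construction sequence, only their eigenvalues do.

  The columns are nonzero and pairwise orthogonal: \<open>\<C>(j - 1)\<close> for \<open>j \<ge> 2\<close> sums to zero, and each
  column of a later node is constant on its support. Hence any matrix with these columns, in any
  order, is nonsingular (\<open>invertible_mat_of_orthogonal_cols\<close>).

  What remains is the order. The algorithm outputs first the all-ones vector, then the unions by
  decreasing \<open>i\<close>, then the joins by increasing \<open>i\<close> (\<open>alg_output_eq\<close>). As \<open>i\<close> grows by one, \<open>J i\<close>
  stays or drops by one; so \<open>J i\<close> is nonincreasing and \<open>J i + i\<close> is nondecreasing. This sorts the
  unions, sorts the joins, and also puts every union below every join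
  (\<open>sorted_node_eigenvalues\<close>). Finally, a diagonalisation of the Laplacian whose diagonal is
  sorted must have the ordered spectrum on that diagonal
  (\<open>sorted_proots_char_poly_modal_matrix\<close>).
\<close>

section \<open>The Laplacian of a threshold graph\<close>

lemma parcs_threshold_graph:
  "(a, b) \<in> parcs (threshold_graph T n) \<longleftrightarrow>
     a \<in> {1..n} \<and> b \<in> {1..n} \<and> a \<noteq> b \<and> T (max a b) \<noteq> 0"
proof (induction T n rule: threshold_graph.induct)
  case (3 T m)
  have V: "pverts (threshold_graph T (Suc m)) = {1..Suc m}"
    by (rule pverts_threshold_graph)
  show ?case
    using "3.IH" V
    by (cases "a = Suc (Suc m)"; cases "b = Suc (Suc m)")
       (auto simp: Let_def union_node_def join_node_def max_def le_Suc_eq)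
qed auto

lemma laplacian_carrier: "laplacian G \<in> carrier_mat (card (pverts G)) (card (pverts G))"
  by (auto simp: laplacian_def degree_matrix_def adjacency_matrix_def Let_def mat_diag_def)

text \<open>
  Row \<open>a\<close> of the Laplacian sums the differences along the edges at \<open>a\<close>; in this form, neighbours at
  which a vector takes the same value as at \<open>a\<close> drop out.
\<close>

lemma laplacian_mult_vec_index:
  assumes x: "x \<in> carrier_vec n" and a: "a < n"
  shows "(laplacian (threshold_graph T n) *\<^sub>v x) $ a =
    (\<Sum>b<n. if a \<noteq> b \<and> T (Suc (max a b)) \<noteq> 0 then x $ a - x $ b else 0)"
proof -
  let ?G = "threshold_graph T n"
  let ?adj = "\<lambda>b. a \<noteq> b \<and> T (Suc (max a b)) \<noteq> 0"
  have cd: "card (pverts ?G) = n" by (simp add: pverts_threshold_graph)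
  have "out_arcs (with_proj ?G) (Suc a) = (\<lambda>b. (Suc a, Suc b)) ` {b \<in> {..<n}. ?adj b}"
  proof (intro Set.set_eqI iffI)
    fix e assume "e \<in> out_arcs (with_proj ?G) (Suc a)"
    then obtain c where e: "e = (Suc a, c)" and c: "(Suc a, c) \<in> parcs ?G"
      by (cases e) (auto simp: out_arcs_def)
    then obtain b where "c = Suc b" by (cases c) (auto simp: parcs_threshold_graph)
    then show "e \<in> (\<lambda>b. (Suc a, Suc b)) ` {b \<in> {..<n}. ?adj b}"
      using e c by (auto simp: parcs_threshold_graph)
  qed (use a in \<open>auto simp: out_arcs_def parcs_threshold_graph\<close>)
  moreover have "inj_on (\<lambda>b. (Suc a, Suc b)) {b \<in> {..<n}. ?adj b}"
    by (rule inj_onI) simp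
  ultimately have "out_degree (with_proj ?G) (Suc a) = card {b \<in> {..<n}. ?adj b}"
    by (simp add: out_degree_def card_image)
  also have "real \<dots> = (\<Sum>b<n. if ?adj b then 1 else 0)"
    by (simp add: sum.If_cases Int_def)
  finally have deg: "real (out_degree (with_proj ?G) (Suc a)) = (\<Sum>b<n. if ?adj b then 1 else 0)" .
  have "(laplacian ?G *\<^sub>v x) $ a =
      (\<Sum>b<n. ((if a = b then real (out_degree (with_proj ?G) (Suc b)) else 0)
        - (if ?adj b then 1 else 0)) * x $ b)"
    using a x cd
    by (auto simp: scalar_prod_def laplacian_def degree_matrix_def adjacency_matrix_def mat_diag_def
        parcs_threshold_graph atLeast0LessThan intro!: sum.cong)
  also have "\<dots> = (\<Sum>b<n. (if a = b then real (out_degree (with_proj ?G) (Suc b)) * x $ b else 0))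
      - (\<Sum>b<n. if ?adj b then x $ b else 0)"
    unfolding sum_subtractf[symmetric] by (rule sum.cong) (auto simp: algebra_simps)
  also have "(\<Sum>b<n. (if a = b then real (out_degree (with_proj ?G) (Suc b)) * x $ b else 0))
      = real (out_degree (with_proj ?G) (Suc a)) * x $ a"
    using a by simp
  also have "\<dots> = (\<Sum>b<n. if ?adj b then x $ a else 0)"
    unfolding deg sum_distrib_right by (rule sum.cong) auto
  also have "\<dots> - (\<Sum>b<n. if ?adj b then x $ b else 0) =
      (\<Sum>b<n. if ?adj b then x $ a - x $ b else 0)"
    unfolding sum_subtractf[symmetric] by (rule sum.cong) auto
  finally show ?thesis .
qed

section \<open>Eigenvectors and eigenvalues\<close>

text \<open>
  The vectors \<open>\<C>(1), \<dots>, \<C>(n - 1)\<close> belong to the nodes \<open>2, \<dots>, n\<close>. Letting the all-ones vector stand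
  for node \<open>1\<close> indexes the columns by nodes.
\<close>

definition node_column :: "nat \<Rightarrow> nat \<Rightarrow> real vec" where
  "node_column n i = (if i = 1 then vec n (\<lambda>_. 1) else cvec n (i - 1))"

definition joins_after :: "nat \<Rightarrow> (nat \<Rightarrow> nat) \<Rightarrow> nat \<Rightarrow> nat" where
  "joins_after n T i = card {j \<in> {i<..n}. T j \<noteq> 0}"

text \<open>
  Node \<open>1\<close> is an exception since its column is the all-ones vector, which lies in the kernel.
  The values are natural numbers; they are cast to reals where they meet the matrices.
\<close>

definition node_eigenvalue :: "nat \<Rightarrow> (nat \<Rightarrow> nat) \<Rightarrow> nat \<Rightarrow> nat" where
  "node_eigenvalue n T i =
     (if i = 1 then 0 else joins_after n T i + (if T i = 0 then 0 else i))"

lemma node_column_carrier [simp]: "node_column n i \<in> carrier_vec n"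
  by (simp add: node_column_def cvec_def)

lemma sum_split_at:
  fixes f :: "nat \<Rightarrow> real"
  assumes "m < n"
  shows "(\<Sum>b<n. f b) = (\<Sum>b<m. f b) + f m + (\<Sum>b\<in>{m<..<n}. f b)"
proof -
  have "{..<n} = {..<m} \<union> {m} \<union> {m<..<n}" using assms by auto
  then have "(\<Sum>b<n. f b) = (\<Sum>b\<in>{..<m} \<union> {m} \<union> {m<..<n}. f b)" by simp
  also have "\<dots> = (\<Sum>b<m. f b) + f m + (\<Sum>b\<in>{m<..<n}. f b)"
    by (subst sum.union_disjoint; (subst sum.union_disjoint)?) auto
  finally show ?thesis .
qed

lemma sum_cvec_eq_0:
  assumes "m < n"
  shows "(\<Sum>b<n. cvec n m $ b) = 0"
  unfolding sum_split_at[OF assms] using assms by (simp add: cvec_def)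

text \<open>
  The shift by \<open>Suc\<close> translates between matrix indices, counted from \<open>0\<close>, and nodes.
\<close>

lemma sum_joins_after:
  "(\<Sum>b\<in>{m<..<n}. if T (Suc b) \<noteq> 0 then c else 0) = real (joins_after n T (Suc m)) * c"
proof -
  have "{j \<in> {Suc m<..n}. T j \<noteq> 0} = Suc ` {b \<in> {m<..<n}. T (Suc b) \<noteq> 0}"
  proof (intro Set.set_eqI iffI)
    fix j assume j: "j \<in> {j \<in> {Suc m<..n}. T j \<noteq> 0}"
    then obtain b where "j = Suc b" by (cases j) auto
    then show "j \<in> Suc ` {b \<in> {m<..<n}. T (Suc b) \<noteq> 0}" using j by auto
  qed auto
  then have "joins_after n T (Suc m) = card {b \<in> {m<..<n}. T (Suc b) \<noteq> 0}"
    by (simp add: joins_after_def card_image)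
  then show ?thesis
    by (simp add: sum.If_cases Int_def)
qed

text \<open>
  Evaluate row \<open>a\<close> on \<open>x = \<C>(m)\<close>, where index \<open>m\<close> is node \<open>m + 1\<close>. If \<open>a > m\<close>, then \<open>x\<close> vanishes at
  \<open>a\<close>, and \<open>a\<close> is adjacent to all or to none of the support of \<open>x\<close>, whose entries sum to zero. If
  \<open>a \<le> m\<close>, the vertices beyond \<open>m\<close> carry the value \<open>0\<close>, so each later join contributes \<open>x\<^sub>a\<close>. The
  vertices up to \<open>m\<close> contribute only if \<open>m\<close> is a join: one edge of difference \<open>1 + m\<close> when
  \<open>a < m\<close>, and \<open>m\<close> edges of difference \<open>- m - 1\<close> when \<open>a = m\<close>, which in both cases is \<open>(m + 1) x\<^sub>a\<close>.
\<close>

lemma laplacian_mult_cvec: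
  assumes m: "1 \<le> m" "m < n"
  shows "laplacian (threshold_graph T n) *\<^sub>v cvec n m =
    real (node_eigenvalue n T (Suc m)) \<cdot>\<^sub>v cvec n m"
proof (rule eq_vecI)
  show "dim_vec (laplacian (threshold_graph T n) *\<^sub>v cvec n m) =
      dim_vec (real (node_eigenvalue n T (Suc m)) \<cdot>\<^sub>v cvec n m)"
    using laplacian_carrier[of "threshold_graph T n"]
    by (simp add: cvec_def pverts_threshold_graph)
next
  fix a assume "a < dim_vec (real (node_eigenvalue n T (Suc m)) \<cdot>\<^sub>v cvec n m)"
  then have a: "a < n" by (simp add: cvec_def)
  let ?x = "cvec n m"
  define f where "f b = (if a \<noteq> b \<and> T (Suc (max a b)) \<noteq> 0 then ?x $ a - ?x $ b else 0)" for b
  have x: "?x $ b = (if b < m then 1 else if b = m then - real m else 0)" if "b < n" for b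
    using that by (simp add: cvec_def)
  have ev: "real (node_eigenvalue n T (Suc m)) =
      real (joins_after n T (Suc m)) + (if T (Suc m) = 0 then 0 else real m + 1)"
    using m by (simp add: node_eigenvalue_def)
  have Lx: "(laplacian (threshold_graph T n) *\<^sub>v ?x) $ a = (\<Sum>b<n. f b)"
    unfolding f_def using a by (intro laplacian_mult_vec_index) (simp_all add: cvec_def)
  consider "a > m" | "a \<le> m" by linarith
  then have "(\<Sum>b<n. f b) = real (node_eigenvalue n T (Suc m)) * ?x $ a"
  proof cases
    case 1
    have "(\<Sum>b<n. f b) = (\<Sum>b<n. (if T (Suc a) \<noteq> 0 then - 1 else 0) * ?x $ b)"
      using 1 a by (intro sum.cong) (auto simp: f_def x)
    also have "\<dots> = (if T (Suc a) \<noteq> 0 then - 1 else 0) * (\<Sum>b<n. ?x $ b)"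
      by (rule sum_distrib_left[symmetric])
    also have "\<dots> = 0"
      by (simp only: sum_cvec_eq_0[OF m(2)] mult_zero_right)
    finally show ?thesis using 1 a by (simp add: x)
  next
    case 2
    have "(\<Sum>b\<in>{m<..<n}. f b) = (\<Sum>b\<in>{m<..<n}. if T (Suc b) \<noteq> 0 then ?x $ a else 0)"
      using 2 by (intro sum.cong) (auto simp: f_def x max_def)
    also have "\<dots> = real (joins_after n T (Suc m)) * ?x $ a"
      by (rule sum_joins_after)
    finally have later: "(\<Sum>b\<in>{m<..<n}. f b) = real (joins_after n T (Suc m)) * ?x $ a" .
    have "(\<Sum>b<m. f b) + f m = (if T (Suc m) = 0 then 0 else real m + 1) * ?x $ a"
    proof (cases "a = m")
      case True
      then have "(\<Sum>b<m. f b) = (\<Sum>b<m. if T (Suc m) = 0 then 0 else - real m - 1)"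
        using m by (intro sum.cong) (auto simp: f_def x max_def)
      then show ?thesis using True m by (simp add: f_def x algebra_simps)
    next
      case False
      then have "(\<Sum>b<m. f b) = 0"
        using m 2 by (intro sum.neutral) (auto simp: f_def x)
      then show ?thesis using False 2 m by (simp add: f_def x max_def)
    qed
    then show ?thesis
      unfolding sum_split_at[OF m(2)] later ev by (simp add: algebra_simps)
  qed
  then show "(laplacian (threshold_graph T n) *\<^sub>v ?x) $ a =
      (real (node_eigenvalue n T (Suc m)) \<cdot>\<^sub>v ?x) $ a"
    using Lx a by (simp add: cvec_def)
qed

lemma laplacian_mult_node_column:
  assumes "i \<in> {1..n}"
  shows "laplacian (threshold_graph T n) *\<^sub>v node_column n i =
    real (node_eigenvalue n T i) \<cdot>\<^sub>v node_column n i"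
proof (cases "i = 1")
  case True
  have "dim_row (laplacian (threshold_graph T n)) = n"
    using laplacian_carrier[of "threshold_graph T n"] by (simp add: pverts_threshold_graph)
  then show ?thesis
    using True laplacian_mult_vec_index[of "vec n (\<lambda>_. 1)" n _ T]
    by (intro eq_vecI) (auto simp: node_column_def node_eigenvalue_def cong: if_cong)
next
  case False
  then obtain m where m: "i = Suc m" "1 \<le> m" "m < n"
    using assms by (cases i) auto
  then show ?thesis
    using laplacian_mult_cvec[of m n T] by (simp add: node_column_def)
qed

section \<open>Orthogonality\<close>

text \<open>
  The column of the later node is constant on the support of the earlier one, and the earlier column
  sums to zero. For \<open>i = 1\<close> the roles are exchanged: the constant column is the earlier one.
\<close>

lemma node_column_orthogonal_less:
  assumes "i \<in> {1..n}" "j \<in> {1..n}" "i < j"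
  shows "node_column n i \<bullet> node_column n j = 0"
proof -
  have j: "node_column n j = cvec n (j - 1)" "j - 1 < n"
    using assms by (auto simp: node_column_def)
  show ?thesis
  proof (cases "i = 1")
    case True
    have "node_column n i \<bullet> node_column n j = (\<Sum>b<n. cvec n (j - 1) $ b)"
      unfolding j scalar_prod_def using True
      by (auto simp: node_column_def cvec_def atLeast0LessThan intro!: sum.cong)
    then show ?thesis using sum_cvec_eq_0[OF j(2)] by simp
  next
    case False
    have i: "node_column n i = cvec n (i - 1)" "i - 1 < n"
      using assms False by (auto simp: node_column_def)
    have "node_column n i \<bullet> node_column n j = (\<Sum>b<n. cvec n (i - 1) $ b)"
      unfolding i j scalar_prod_def using assms False
      by (auto simp: cvec_def atLeast0LessThan intro!: sum.cong)
    then show ?thesis using sum_cvec_eq_0[OF i(2)] by simp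
  qed
qed

lemma node_column_orthogonal:
  assumes "i \<in> {1..n}" "j \<in> {1..n}" "i \<noteq> j"
  shows "node_column n i \<bullet> node_column n j = 0"
proof (cases "i < j")
  case True
  then show ?thesis using assms by (intro node_column_orthogonal_less)
next
  case False
  have comm: "node_column n i \<bullet> node_column n j = node_column n j \<bullet> node_column n i"
    by (rule comm_scalar_prod[OF node_column_carrier node_column_carrier])
  have "j < i" using False assms(3) by linarith
  have "node_column n j \<bullet> node_column n i = 0"
    by (rule node_column_orthogonal_less[OF assms(2,1) \<open>j < i\<close>])
  with comm show ?thesis by (rule trans)
qed

lemma node_column_norm_neq_0:
  assumes "i \<in> {1..n}"
  shows "node_column n i \<bullet> node_column n i \<noteq> 0"
proof -
  \<comment> \<open>Every column, including \<open>\<C>(1)\<close>, starts with the entry \<open>1\<close>.\<close>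
  have "node_column n i $ 0 = 1" and n: "0 < n"
    using assms by (auto simp: node_column_def cvec_def)
  then have "0 < node_column n i $ 0 * node_column n i $ 0" by simp
  also have "\<dots> \<le> (\<Sum>b<n. node_column n i $ b * node_column n i $ b)"
    using n by (intro member_le_sum) auto
  finally show ?thesis
    unfolding scalar_prod_def carrier_vecD[OF node_column_carrier]
    by (simp add: atLeast0LessThan)
qed

text \<open>
  The Gram matrix \<open>V\<^sup>T V\<close> is diagonal with nonzero diagonal, so rescaling \<open>V\<^sup>T\<close> by the inverse
  diagonal gives a left inverse of the square matrix \<open>V\<close>.
\<close>

lemma invertible_mat_of_orthogonal_cols:
  fixes vs :: "real vec list"
  assumes carrier: "set vs \<subseteq> carrier_vec n" and len: "length vs = n"
    and orth: "\<And>i j. i < n \<Longrightarrow> j < n \<Longrightarrow> i \<noteq> j \<Longrightarrow> vs ! i \<bullet> vs ! j = 0"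
    and nz: "\<And>i. i < n \<Longrightarrow> vs ! i \<bullet> vs ! i \<noteq> 0"
  shows "invertible_mat (mat_of_cols n vs)"
proof -
  let ?V = "mat_of_cols n vs"
  let ?D = "mat_diag n (\<lambda>i. 1 / (vs ! i \<bullet> vs ! i))"
  have V: "?V \<in> carrier_mat n n" using len mat_of_cols_carrier(1)[of n vs] by simp
  have col: "col ?V j = vs ! j" if "j < n" for j
    using that carrier len by (intro col_mat_of_cols) (auto dest: nth_mem)
  have gram: "?V\<^sup>T * ?V = mat_diag n (\<lambda>i. vs ! i \<bullet> vs ! i)"
    using V col orth by (intro eq_matI) (auto simp: mat_diag_def len)
  have B: "?D * ?V\<^sup>T \<in> carrier_mat n n" using V by (intro mult_carrier_mat[of _ _ n]) auto
  have "(?D * ?V\<^sup>T) * ?V = ?D * (?V\<^sup>T * ?V)"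
    using V by (intro assoc_mult_mat[of _ n n _ n _ n]) auto
  also have "\<dots> = mat_diag n (\<lambda>i. 1)"
    unfolding gram mat_diag_diag using nz by (auto simp: mat_diag_def)
  finally have left: "(?D * ?V\<^sup>T) * ?V = 1\<^sub>m n" by simp
  have "?V * (?D * ?V\<^sup>T) = 1\<^sub>m n"
    by (rule mat_mult_left_right_inverse[OF B V left])
  then show ?thesis
    using left V carrier_matD[OF B] unfolding invertible_mat_def inverts_mat_def
    by (auto intro!: exI[of _ "?D * ?V\<^sup>T"])
qed

section \<open>Diagonalisation determines the ordered spectrum\<close>

lemma proots_prod_linear_factors:
  "proots (\<Prod>a\<leftarrow>ls. [:- a, 1:]) = mset (ls :: real list)"
proof (induction ls)
  case (Cons a ls)
  have "(\<Prod>a\<leftarrow>ls. [:- a, 1:]) \<noteq> 0"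
    by (auto simp: prod_list_zero_iff)
  then have "proots ([:- a, 1:] * (\<Prod>a\<leftarrow>ls. [:- a, 1:])) =
      proots [:- a, 1:] + proots (\<Prod>a\<leftarrow>ls. [:- a, 1:])"
    by (intro proots_mult) simp_all
  then show ?case using Cons.IH by simp
qed simp

text \<open>
  A modal matrix exhibits \<open>L\<close> as similar to a diagonal matrix, so the characteristic polynomial
  splits with exactly the diagonal entries as roots, multiplicities included. A multiset has only
  one sorted enumeration.
\<close>

lemma sorted_proots_char_poly_modal_matrix:
  assumes L: "L \<in> carrier_mat n n" and len: "length ls = n"
    and modal: "modal_matrix L ls V" and sorted: "sorted ls"
  shows "sorted_list_of_multiset (proots (char_poly L)) = ls"
proof -
  let ?D = "mat_diag n (\<lambda>i. ls ! i)"
  have V: "V \<in> carrier_mat n n" and inv: "invertible_mat V" and LV: "L * V = V * ?D"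
    using modal L len by (auto simp: modal_matrix_def)
  obtain B where VB: "V * B = 1\<^sub>m n" and BV: "B * V = 1\<^sub>m (dim_row B)"
    using inv V by (auto simp: invertible_mat_def inverts_mat_def)
  have B: "B \<in> carrier_mat n n"
    using arg_cong[OF VB, of dim_col] arg_cong[OF BV, of dim_col] V by auto
  have D: "?D \<in> carrier_mat n n" by simp
  have "L = L * (V * B)" using L VB by simp
  also have "\<dots> = L * V * B" by (rule assoc_mult_mat[OF L V B, symmetric])
  finally have "L = V * ?D * B" unfolding LV .
  then have "similar_mat_wit L ?D V B"
    using L V B D VB BV unfolding similar_mat_wit_def Let_def by (auto simp del: assoc_mult_mat)
  then have "char_poly L = char_poly ?D"
    by (intro char_poly_similar) (auto simp: similar_mat_def)
  also have "\<dots> = (\<Prod>a\<leftarrow>diag_mat ?D. [:- a, 1:])"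
    by (rule char_poly_upper_triangular[OF D]) (auto simp: mat_diag_def)
  also have "diag_mat ?D = ls"
    using len by (auto simp: diag_mat_def mat_diag_def intro: nth_equalityI)
  finally have "proots (char_poly L) = mset ls"
    by (simp add: proots_prod_linear_factors)
  then show ?thesis
    using sorted by (simp add: sort_key_id_if_sorted sorted_sort_id)
qed

section \<open>The output of the algorithm\<close>

definition column_order :: "nat \<Rightarrow> (nat \<Rightarrow> nat) \<Rightarrow> nat list" where
  "column_order n T =
     1 # filter (\<lambda>i. T i = 0) (rev [2..<Suc n]) @ filter (\<lambda>i. T i \<noteq> 0) [2..<Suc n]"

text \<open>
  The loop fills the columns from both ends towards the middle. When \<open>k\<close> columns on the left and \<open>r\<close>
  on the right are filled and \<open>xs\<close> lists the nodes still to come, the gap has exactly \<open>length xs\<close>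
  columns. Thus no step overwrites a filled column, and none is left unassigned at the end. Columns
  added from the right end up in reverse order of processing.
\<close>

lemma fold_alg_step_columns:
  assumes "k + r + length xs = n"
  shows "map (fst (fold (alg_step n T) xs (V, k, r))) [1..<Suc n] =
    map V [1..<Suc k]
    @ map (\<lambda>i. cvec n (i - 1)) (filter (\<lambda>i. T i = 0) xs @ filter (\<lambda>i. T i \<noteq> 0) (rev xs))
    @ map V [Suc (n - r)..<Suc n]"
  using assms
proof (induction xs arbitrary: V k r)
  case Nil
  then have "[1..<Suc n] = [1..<Suc k] @ [Suc (n - r)..<Suc n]"
    using upt_add_eq_append[of 1 "Suc k" r] by (auto simp del: upt_Suc)
  then show ?case by (simp del: upt_Suc)
next
  case (Cons i xs)
  show ?case
  proof (cases "T i = 0")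
    case True
    have "map (V(k + 1 := cvec n (i - 1))) [1..<Suc (k + 1)] =
        map V [1..<Suc k] @ [cvec n (i - 1)]"
      by simp
    moreover have "map (V(k + 1 := cvec n (i - 1))) [Suc (n - r)..<Suc n] =
        map V [Suc (n - r)..<Suc n]"
      using Cons.prems by (intro map_cong) auto
    ultimately show ?thesis
      using True Cons.prems Cons.IH[of "k + 1" r "V(k + 1 := cvec n (i - 1))"]
      by (simp add: alg_step_def del: upt_Suc fun_upd_apply)
  next
    case False
    have "[Suc (n - Suc r)..<Suc n] = (n - r) # [Suc (n - r)..<Suc n]"
      using Cons.prems by (subst upt_conv_Cons) (auto simp: Suc_diff_Suc simp del: upt_Suc)
    then have "map (V(n - r := cvec n (i - 1))) [Suc (n - Suc r)..<Suc n] =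
        cvec n (i - 1) # map V [Suc (n - r)..<Suc n]"
      by (simp del: upt_Suc)
    moreover have "map (V(n - r := cvec n (i - 1))) [1..<Suc k] = map V [1..<Suc k]"
      using Cons.prems by (intro map_cong) auto
    ultimately show ?thesis
      using False Cons.prems Cons.IH[of k "r + 1" "V(n - r := cvec n (i - 1))"]
      by (simp add: alg_step_def del: upt_Suc fun_upd_apply)
  qed
qed

lemma alg_output_eq:
  assumes "1 \<le> n"
  shows "alg_output n T = mat_of_cols n (map (node_column n) (column_order n T))"
proof -
  let ?st = "fold (alg_step n T) (rev [2..<Suc n]) (alg_init n)"
  have later: "map (\<lambda>i. cvec n (i - 1)) xs = map (node_column n) xs" if "1 \<notin> set xs" for xs
    using that by (intro map_cong) (auto simp: node_column_def)
  have "map (fst ?st) [1..<Suc n] =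
      map ((\<lambda>_. 0\<^sub>v n)(1 := vec n (\<lambda>_. 1))) [1..<Suc 1]
      @ map (\<lambda>i. cvec n (i - 1)) (filter (\<lambda>i. T i = 0) (rev [2..<Suc n])
          @ filter (\<lambda>i. T i \<noteq> 0) (rev (rev [2..<Suc n])))
      @ map ((\<lambda>_. 0\<^sub>v n)(1 := vec n (\<lambda>_. 1))) [Suc (n - 0)..<Suc n]"
    unfolding alg_init_def using assms by (intro fold_alg_step_columns) (auto simp del: upt_Suc)
  also have "\<dots> = map (node_column n) (column_order n T)"
    by (subst later) (simp_all add: column_order_def node_column_def del: upt_Suc, simp)
  finally have "map (fst ?st) [1..<Suc n] = map (node_column n) (column_order n T)" .
  then show ?thesis
    by (simp add: alg_output_def case_prod_unfold Let_def del: upt_Suc)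
qed

lemma mset_column_order:
  assumes "1 \<le> n"
  shows "mset (column_order n T) = mset [1..<Suc n]"
proof -
  have "[1..<Suc n] = 1 # [2..<Suc n]"
    using assms by (subst upt_conv_Cons) (auto simp: numeral_2_eq_2 simp del: upt_Suc)
  then show ?thesis
    by (simp add: column_order_def mset_filter del: upt_Suc mset_upt)
qed

lemma joins_after_antimono:
  "i \<le> j \<Longrightarrow> joins_after n T j \<le> joins_after n T i"
  unfolding joins_after_def by (intro card_mono) auto

text \<open>
  Of the joins after \<open>i\<close>, at most \<open>j - i\<close> are not after \<open>j\<close>.
\<close>

lemma joins_after_le_add:
  assumes "i \<le> j"
  shows "joins_after n T i + i \<le> joins_after n T j + j"
proof -
  have "joins_after n T i \<le> card ({j' \<in> {j<..n}. T j' \<noteq> 0} \<union> {i<..j})"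
    unfolding joins_after_def by (intro card_mono) auto
  also have "\<dots> \<le> joins_after n T j + card {i<..j}"
    unfolding joins_after_def by (rule card_Un_le)
  finally show ?thesis using assms by simp
qed

text \<open>
  Both monotonicity facts are needed to compare a union \<open>i\<close> with a join \<open>j\<close>, since either may come
  first: \<open>J i \<le> J j + j\<close> follows from \<open>J i + i \<le> J j + j\<close> if \<open>i \<le> j\<close>, and from \<open>J i \<le> J j\<close> otherwise.
\<close>

lemma sorted_node_eigenvalues:
  "sorted (map (node_eigenvalue n T) (column_order n T))"
proof -
  let ?us = "filter (\<lambda>i. T i = 0) (rev [2..<Suc n])"
  let ?js = "filter (\<lambda>i. T i \<noteq> 0) [2..<Suc n]"
  have upt: "sorted_wrt (<) [2..<Suc n]" by (rule sorted_wrt_upt)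
  have "sorted_wrt (\<lambda>i j. j < i) ?us"
    using upt by (intro sorted_wrt_filter) (simp add: sorted_wrt_rev del: upt_Suc)
  then have us: "sorted (map (node_eigenvalue n T) ?us)"
    unfolding sorted_map
    by (rule sorted_wrt_mono_rel[rotated])
       (auto simp: node_eigenvalue_def intro!: joins_after_antimono simp del: upt_Suc)
  have "sorted_wrt (<) ?js"
    using upt by (rule sorted_wrt_filter)
  then have js: "sorted (map (node_eigenvalue n T) ?js)"
    unfolding sorted_map
    by (rule sorted_wrt_mono_rel[rotated])
       (auto simp: node_eigenvalue_def intro!: joins_after_le_add simp del: upt_Suc)
  have "node_eigenvalue n T i \<le> node_eigenvalue n T j" if "i \<in> set ?us" "j \<in> set ?js" for i j
    using that joins_after_le_add[of i j n T] joins_after_antimono[of j i n T]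
    by (cases "i \<le> j") (auto simp: node_eigenvalue_def simp del: upt_Suc)
  then have "sorted (map (node_eigenvalue n T) (?us @ ?js))"
    using us js by (auto simp: sorted_append simp del: upt_Suc)
  then show ?thesis
    unfolding column_order_def by (simp add: node_eigenvalue_def[of n T 1] del: upt_Suc One_nat_def)
qed

lemma modal_matrix_alg_output:
  assumes "1 \<le> n"
  shows "modal_matrix (laplacian (threshold_graph T n))
    (map (\<lambda>i. real (node_eigenvalue n T i)) (column_order n T)) (alg_output n T)"
proof -
  let ?L = "laplacian (threshold_graph T n)"
  let ?is = "column_order n T"
  let ?ls = "map (\<lambda>i. real (node_eigenvalue n T i)) ?is"
  let ?vs = "map (node_column n) ?is"
  let ?V = "mat_of_cols n ?vs"
  have ms: "mset ?is = mset [1..<Suc n]" by (rule mset_column_order[OF assms])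
  have len: "length ?is = n" using arg_cong[OF ms, of size] by (simp del: upt_Suc)
  have set: "set ?is = {1..n}"
    using mset_eq_setD[OF ms] by auto
  have dist: "distinct ?is" using mset_eq_imp_distinct_iff[OF ms] by simp
  have mem: "?is ! p \<in> {1..n}" if "p < n" for p
    using nth_mem[of p ?is] that len set by simp
  have L: "?L \<in> carrier_mat n n"
    using laplacian_carrier[of "threshold_graph T n"] by (simp add: pverts_threshold_graph)
  have V: "?V \<in> carrier_mat n n" using mat_of_cols_carrier(1)[of n ?vs] len by simp
  have "invertible_mat ?V"
  proof (rule invertible_mat_of_orthogonal_cols)
    show "?vs ! p \<bullet> ?vs ! q = 0" if "p < n" "q < n" "p \<noteq> q" for p q
      using that len mem dist by (simp add: node_column_orthogonal nth_eq_iff_index_eq)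
    show "?vs ! p \<bullet> ?vs ! p \<noteq> 0" if "p < n" for p
      using that len node_column_norm_neq_0[OF mem] by simp
  qed (use len in auto)
  moreover have "?L * ?V = ?V * mat_diag n (\<lambda>p. ?ls ! p)"
  proof (rule mat_col_eqI)
    fix p assume "p < dim_col (?V * mat_diag n (\<lambda>p. ?ls ! p))"
    then have p: "p < n" by (simp add: mat_diag_def)
    have c: "col ?V p = node_column n (?is ! p)"
      using p len by (subst col_mat_of_cols) auto
    have "col (?L * ?V) p = ?ls ! p \<cdot>\<^sub>v col ?V p"
      unfolding col_mult2[OF L V p] c laplacian_mult_node_column[OF mem[OF p]]
      using p len by simp
    also have "\<dots> = col (?V * mat_diag n (\<lambda>p. ?ls ! p)) p"
      unfolding mat_diag_mult_right[OF V] using p V len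
      by (intro eq_vecI)
         (auto simp: mat_of_cols_index carrier_vecD[OF node_column_carrier] mult.commute)
    finally show "col (?L * ?V) p = col (?V * mat_diag n (\<lambda>p. ?ls ! p)) p" .
  qed (use L V in \<open>auto simp: mat_diag_def len\<close>)
  ultimately show ?thesis
    using V L len by (simp add: modal_matrix_def alg_output_eq[OF assms])
qed

theorem theorem3:
  fixes n :: nat and T :: "nat \<Rightarrow> nat" and G :: "nat pair_pre_digraph"
  assumes "construction_sequence n T"
    and "G = threshold_graph T n"
  shows "length (laplacian_spectrum G) = n \<and>
    laplacian_spectrum G ! 0 = 0 \<and>
    sorted (laplacian_spectrum G) \<and>
    modal_matrix (laplacian G) (laplacian_spectrum G) (alg_output n T)"
proof -
  let ?ls = "map (\<lambda>i. real (node_eigenvalue n T i)) (column_order n T)"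
  have n: "1 \<le> n" using assms(1) by (simp add: construction_sequence_def)
  have L: "laplacian G \<in> carrier_mat n n"
    using laplacian_carrier[of G] by (simp add: assms(2) pverts_threshold_graph)
  have modal: "modal_matrix (laplacian G) ?ls (alg_output n T)"
    using modal_matrix_alg_output[OF n] assms(2) by simp
  have len: "length ?ls = n"
    using arg_cong[OF mset_column_order[OF n], of size T] by (simp del: upt_Suc)
  have sorted: "sorted ?ls"
    using sorted_node_eigenvalues[of n T] by (simp add: sorted_map)
  have "laplacian_spectrum G = ?ls"
    unfolding laplacian_spectrum_def
    by (rule sorted_proots_char_poly_modal_matrix[OF L len modal sorted])
  moreover have "?ls ! 0 = 0"
    by (simp add: column_order_def node_eigenvalue_def)
  ultimately show ?thesis
    using len sorted modal by simp
qed

end
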